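(* For every integer $m\ge 2$, $$\sum_{k=2}^m c_{mk}\, k = m.$$
   Context: For an integer $k\ge 2$ let $\psi_k(n) = n + (k-1)(n-1)B_{n-1,k-1}$, where $B_{a,b}=\frac{(a+b)!}{a!\,b!}$, for positive integers $n$; equivalently $\psi_k$ is the polynomial of degree $k$ in $n$ given by $\psi_k(n) = n + \frac{n-1}{(k-2)!}\prod_{j=0}^{k-2}(n+j)$. For $m\ge 2$, the coefficients $c_{mk}$ ($2\le k\le m$) are the unique rational numbers defined by the polynomial identity $n^m = \sum_{k=2}^m c_{mk}\psi_k(n)$. *)

theory Defs
  imports "HOL-Computational_Algebra.Polynomial"
begin

definition B :: "nat \<Rightarrow> nat \<Rightarrow> rat" where
  "B a b = fact (a + b) / (fact a * fact b)"

text \<open>The polynomial in the indeterminate \<open>n\<close>; it is meaningful for \<open>k \<ge> 2\<close>, where the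
  lemma \<open>poly_psi\<close> below gives its values at positive integers in terms of \<open>B\<close>.\<close>

definition psi :: "nat \<Rightarrow> rat poly" where
  "psi k = [:0, 1:] + smult (1 / fact (k - 2)) ([:-1, 1:] * (\<Prod>j=0..k-2. [:of_nat j, 1:]))"

lemma poly_psi:
  assumes "k \<ge> 2" "n \<ge> 1"
  shows "poly (psi k) (of_nat n) =
    of_nat n + (of_nat k - 1) * (of_nat n - 1) * B (n - 1) (k - 1)"
proof -
  obtain i where k: "k = i + 2" using assms(1) by (metis add.commute le_Suc_ex)
  obtain l where n: "n = Suc l" using assms(2) by (cases n) auto
  have p: "fact l * (\<Prod>j=0..i. (of_nat j + of_nat n :: rat)) = fact (l + Suc i)"
  proof (induction i)
    case 0
    show ?case by (simp add: n algebra_simps)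
  next
    case (Suc i)
    have "fact l * (\<Prod>j=0..Suc i. (of_nat j + of_nat n :: rat)) =
        fact (l + Suc i) * (of_nat (Suc i) + of_nat n)"
      unfolding prod.atLeast0_atMost_Suc Suc.IH[symmetric] by (simp only: mult.assoc)
    also have "of_nat (Suc i) + of_nat n = (of_nat (Suc (l + Suc i)) :: rat)"
      by (simp add: n)
    finally show ?case by (simp only: fact_Suc add_Suc_right mult.commute)
  qed
  have q: "(\<Prod>j=0..i. (of_nat j + of_nat n :: rat)) = fact (l + Suc i) / fact l"
    using p by (simp add: field_simps)
  have nz: "(1 + of_nat i :: rat) \<noteq> 0"
    by (metis of_nat_Suc of_nat_neq_0)
  have "(of_nat k - 1) * B (n - 1) (k - 1) =
      (1 + of_nat i) * (fact (l + Suc i) / (fact l * ((1 + of_nat i) * fact i)))"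
    by (simp add: B_def k n del: add_Suc_right)
  also have "\<dots> = fact (l + Suc i) / (fact l * fact i)"
    using nz by (metis mult.left_commute mult_divide_mult_cancel_left times_divide_eq_right)
  finally have b: "fact (l + Suc i) / (fact l * fact i) = (of_nat k - 1) * B (n - 1) (k - 1)"
    by simp
  have "poly (psi k) (of_nat n) = of_nat n +
      (of_nat n - 1) * (\<Prod>j=0..i. (of_nat j + of_nat n :: rat)) / fact i"
    unfolding psi_def k by (simp add: poly_prod field_simps)
  also have "\<dots> = of_nat n + (of_nat k - 1) * (of_nat n - 1) * B (n - 1) (k - 1)"
    unfolding q mult.assoc mult.left_commute[of "of_nat k - 1"] b[symmetric]
    by (simp only: times_divide_eq_right divide_divide_eq_left)
  finally show ?thesis .
qed

lemma prod_linear_degree: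
  "degree (\<Prod>j=0..i. [:of_nat j, 1 :: rat:]) = Suc i \<and> coeff (\<Prod>j=0..i. [:of_nat j, 1 :: rat:]) (Suc i) = 1"
proof -
  have d: "degree (\<Prod>j=0..i. [:of_nat j, 1 :: rat:]) = Suc i"
    by (subst degree_prod_eq_sum_degree) auto
  have "lead_coeff (\<Prod>j=0..i. [:of_nat j, 1 :: rat:]) = 1"
    by (subst lead_coeff_prod) auto
  with d show ?thesis by simp
qed

lemma psi_facts:
  assumes "k \<ge> 2"
  shows degree_psi: "degree (psi k) = k"
    and coeff_psi_top: "coeff (psi k) k = 1 / fact (k - 2)"
    and coeff_psi_0: "coeff (psi k) 0 = 0"
    and coeff_psi_1: "coeff (psi k) 1 = 0"
proof -
  obtain i where k: "k = i + 2" using assms by (metis add.commute le_Suc_ex)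
  define P where "P = (\<Prod>j=0..i. [:of_nat j, 1 :: rat:])"
  have P: "degree P = Suc i" "coeff P (Suc i) = 1"
    using prod_linear_degree[of i] by (auto simp: P_def)
  have psi: "psi (Suc (Suc i)) = [:0, 1:] + smult (1 / fact i) ([:-1, 1:] * P)"
    by (simp add: psi_def P_def)
  have top: "coeff (psi k) k = 1 / fact i"
    using P by (simp add: psi k coeff_pCons coeff_eq_0 split: nat.split)
  then show "coeff (psi k) k = 1 / fact (k - 2)" by (simp add: k)
  have "degree (psi k) \<le> k"
  proof (rule degree_le, intro allI impI)
    fix j assume "k < j"
    then show "coeff (psi k) j = 0"
      using P by (auto simp: psi k coeff_pCons coeff_eq_0 split: nat.split)
  qed
  moreover have "k \<le> degree (psi k)" by (rule le_degree) (simp add: top)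
  ultimately show "degree (psi k) = k" by simp
  have c0: "coeff P 0 = 0"
    unfolding poly_0_coeff_0[symmetric] P_def by (simp add: poly_prod)
  have "P = [:0, 1:] * (\<Prod>j=1..i. [:of_nat j, 1 :: rat:])"
    unfolding P_def by (simp add: prod.atLeast_Suc_atMost)
  then have "coeff P 1 = poly (\<Prod>j=1..i. [:of_nat j, 1 :: rat:]) 0"
    by (simp add: poly_0_coeff_0)
  also have "\<dots> = fact i"
    by (simp add: poly_prod fact_prod)
  finally have c1: "coeff P 1 = fact i" .
  show "coeff (psi k) 0 = 0" by (simp add: psi k c0)
  show "coeff (psi k) 1 = 0" using c0 c1 by (simp add: psi k)
qed

lemma psi_span:
  assumes "degree p \<le> m" "coeff p 0 = 0" "coeff p 1 = 0" "m \<ge> 1"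
  shows "\<exists>a. p = (\<Sum>k=2..m. smult (a k) (psi k))"
  using assms(4,1-3)
proof (induction m arbitrary: p rule: dec_induct)
  case base
  have "p = 0"
  proof (rule poly_eqI)
    fix j show "coeff p j = coeff 0 j"
      using base by (cases "j \<le> 1") (auto simp: le_Suc_eq coeff_eq_0)
  qed
  then show ?case by simp
next
  case (step m)
  have k2: "Suc m \<ge> 2" using step by simp
  define t where "t = coeff p (Suc m) * fact (Suc m - 2)"
  define r where "r = p - smult t (psi (Suc m))"
  have "coeff r j = 0" if "j > m" for j
    using that step.prems(1) k2
    by (cases "j = Suc m") (auto simp: r_def t_def coeff_psi_top coeff_eq_0 degree_psi)
  then have "degree r \<le> m" by (intro degree_le) auto
  moreover have "coeff r 0 = 0" "coeff r 1 = 0"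
    using step.prems coeff_psi_0[OF k2] coeff_psi_1[OF k2] by (simp_all add: r_def)
  ultimately obtain a where a: "r = (\<Sum>k=2..m. smult (a k) (psi k))"
    using step.IH by blast
  have "p = r + smult t (psi (Suc m))" by (simp add: r_def)
  also have "\<dots> = (\<Sum>k=2..Suc m. smult ((a(Suc m := t)) k) (psi k))"
    using k2 a by simp
  finally show ?case by blast
qed

lemma psi_independent:
  assumes "(\<Sum>k=2..m. smult (a k) (psi k)) = 0" "k \<in> {2..m}"
  shows "a k = 0"
  using assms
proof (induction m)
  case 0
  then show ?case by simp
next
  case (Suc m)
  have k2: "Suc m \<ge> 2" using Suc.prems(2) by simp
  have "coeff (\<Sum>k=2..m. smult (a k) (psi k)) (Suc m) = 0"
    by (auto simp: coeff_sum degree_psi coeff_eq_0 intro!: sum.neutral)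
  moreover have "coeff (\<Sum>k=2..Suc m. smult (a k) (psi k)) (Suc m) = 0"
    using Suc.prems(1) by simp
  ultimately have "a (Suc m) = 0"
    using k2 by (simp add: coeff_psi_top)
  then show ?case using Suc k2 by (cases "k = Suc m") auto
qed

text \<open>The values of \<open>a\<close> outside the range \<open>2 \<le> k \<le> m\<close> are irrelevant; they are set to \<open>0\<close>
  so that the coefficient family is unique as a total function.\<close>

definition is_psi_expansion :: "nat \<Rightarrow> (nat \<Rightarrow> rat) \<Rightarrow> bool" where
  "is_psi_expansion m a \<longleftrightarrow>
     (\<forall>k. k \<notin> {2..m} \<longrightarrow> a k = 0) \<and> monom 1 m = (\<Sum>k=2..m. smult (a k) (psi k))"

definition c :: "nat \<Rightarrow> nat \<Rightarrow> rat" where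
  "c m = (THE a. is_psi_expansion m a)"

lemma ex1_psi_expansion:
  assumes "m \<ge> 2"
  shows "\<exists>!a. is_psi_expansion m a"
proof -
  obtain a where a: "monom 1 m = (\<Sum>k=2..m. smult (a k) (psi k))"
    using psi_span[of "monom 1 m" m] assms by (auto simp: degree_monom_eq)
  show ?thesis
  proof (rule ex1I)
    show "is_psi_expansion m (\<lambda>k. if k \<in> {2..m} then a k else 0)"
      using a by (simp add: is_psi_expansion_def)
  next
    fix b assume b: "is_psi_expansion m b"
    have "(\<Sum>k=2..m. smult (b k - a k) (psi k)) = 0"
      using a b by (simp add: is_psi_expansion_def smult_diff_left sum_subtractf)
    then have "b k - a k = 0" if "k \<in> {2..m}" for k
      using psi_independent[of "\<lambda>k. b k - a k"] that by blast
    then show "b = (\<lambda>k. if k \<in> {2..m} then a k else 0)"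
      using b by (auto simp: is_psi_expansion_def fun_eq_iff)
  qed
qed

end

theory Submission
  imports Defs
begin

text \<open>
  The linear functional \<open>p \<mapsto> p'(1)\<close> takes the value \<open>m\<close> at the monomial \<open>n ^ m\<close> and the value
  \<open>k\<close> at \<open>psi k\<close> (lemma \<open>poly_pderiv_psi_1\<close>). Applied to the expansion of \<open>n ^ m\<close> in the
  \<open>psi k\<close>, it gives the claim.
\<close>

text \<open>Because of the factor \<open>n - 1\<close>, the derivative at \<open>1\<close> of the second summand of \<open>psi k\<close> is just
  the value at \<open>1\<close> of its cofactor, which is \<open>(k - 1)! / (k - 2)! = k - 1\<close>.\<close>

lemma poly_pderiv_psi_1:
  assumes "k \<ge> 2"
  shows "poly (pderiv (psi k)) 1 = of_nat k"
proof -
  obtain i where k: "k = i + 2"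
    using assms by (metis add.commute le_Suc_ex)
  define P where "P = (\<Prod>j=0..i. [:of_nat j, 1 :: rat:])"
  have "poly P 1 = (\<Prod>j=0..i. 1 + of_nat j)"
    by (simp add: P_def poly_prod add.commute)
  also have "\<dots> = fact (Suc i)"
    by (induction i) (simp_all add: algebra_simps)
  finally have P1: "poly P 1 = of_nat (Suc i) * fact i"
    by simp
  have "psi k = [:0, 1:] + smult (1 / fact i) ([:-1, 1:] * P)"
    by (simp add: psi_def k P_def)
  then have "poly (pderiv (psi k)) 1 = 1 + poly P 1 / fact i"
    by (simp only: pderiv_add pderiv_smult pderiv_mult) (simp add: pderiv_pCons)
  then show ?thesis
    unfolding P1 k by simp
qed

lemma monom_eq_sum_c_psi:
  assumes "m \<ge> 2"
  shows "monom 1 m = (\<Sum>k=2..m. smult (c m k) (psi k))"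
proof -
  have "is_psi_expansion m (c m)"
    unfolding c_def using ex1_psi_expansion[OF assms] by (rule theI')
  then show ?thesis
    unfolding is_psi_expansion_def by blast
qed

theorem mainTheorem3:
  fixes m :: nat
  assumes "m \<ge> 2"
  shows "(\<Sum>k=2..m. c m k * of_nat k) = of_nat m"
proof -
  have "of_nat m = poly (pderiv (monom (1 :: rat) m)) 1"
    by (simp add: pderiv_monom poly_monom)
  also have "\<dots> = (\<Sum>k=2..m. c m k * poly (pderiv (psi k)) 1)"
    unfolding monom_eq_sum_c_psi[OF assms]
    using higher_pderiv_sum[of 1 "\<lambda>k. smult (c m k) (psi k)" "{2..m}"]
    by (simp add: pderiv_smult poly_sum)
  also have "\<dots> = (\<Sum>k=2..m. c m k * of_nat k)"
    by (simp add: poly_pderiv_psi_1)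
  finally show ?thesis ..
qed

end
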